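(* Let $T\subset\mathbb{R}^2$ be a triangle, and let $\varrho_{T^{ct}_{\mathrm{inc}}}$ be the aspect ratio of the Clough--Tocher split $T^{ct}$ of $T$ when the split point is the incenter of $T$. Then $$2\,\varrho_T\ \le\ \varrho_{T^{ct}_{\mathrm{inc}}}\ \le\ 2\Big(1+\frac{a_T}{h_T}\Big)\varrho_T .$$
   Context: $T$ is a nondegenerate triangle with vertices $z_1,z_2,z_3$ and edges $e_i$ opposite $z_i$, $h_i=|e_i|$, labeled so that $h_1\le h_2\le h_3$; $h_T=h_3$ is the length of its longest edge and $a_T$ is the altitude of $T$ with respect to the longest edge $e_3$. $\rho_T$ is the diameter of the incircle of $T$. The aspect ratio of any triangle $T$ is $\varrho_T=h_T/\rho_T=|\partial T|h_T/(4|T|)$. The incenter is $\frac{1}{|\partial T|}(h_1z_1+h_2z_2+h_3z_3)$. The Clough--Tocher split $T^{ct}=\{K_1,K_2,K_3\}$ with respect to an interior split point $z_0$ consists of the three triangles obtained by connecting the vertices of $T$ to $z_0$. The aspect ratio of $T^{ct}$ is $\varrho_{T^{ct}}=\max_{K_i\in T^{ct}}\varrho_{K_i}$. *)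

theory Defs
  imports "HOL-Analysis.Analysis"
begin

type_synonym point = "real ^ 2"

text \<open>A triangle is given by its three vertices, in order; its point set is their convex hull.\<close>

type_synonym triangle = "point \<times> point \<times> point"

fun nondegenerate :: "triangle \<Rightarrow> bool" where
  "nondegenerate (a, b, c) \<longleftrightarrow> \<not> collinear {a, b, c}"

fun points :: "triangle \<Rightarrow> point set" where
  "points (a, b, c) = convex hull {a, b, c}"

fun edges :: "triangle \<Rightarrow> point set set" where
  "edges (a, b, c) = {closed_segment b c, closed_segment c a, closed_segment a b}"

fun longest_edge :: "triangle \<Rightarrow> real" where
  "longest_edge (a, b, c) = Max {dist b c, dist c a, dist a b}"

text \<open>The incircle is the circle lying in the triangle and tangent to all three edges, i.e.
  meeting each of them in exactly one point. It is unique for nondegenerate triangles.\<close>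

definition is_incircle :: "triangle \<Rightarrow> point set \<Rightarrow> bool" where
  "is_incircle T S \<longleftrightarrow>
     (\<exists>m r. r > 0 \<and> S = sphere m r) \<and> S \<subseteq> points T \<and> (\<forall>e \<in> edges T. \<exists>!p. p \<in> S \<inter> e)"

definition incircle :: "triangle \<Rightarrow> point set" where
  "incircle T = (THE S. is_incircle T S)"

definition incircle_diameter :: "triangle \<Rightarrow> real" where
  "incircle_diameter T = diameter (incircle T)"

definition aspect_ratio :: "triangle \<Rightarrow> real" where
  "aspect_ratio T = longest_edge T / incircle_diameter T"

fun incenter :: "triangle \<Rightarrow> point" where
  "incenter (a, b, c) =
     (1 / (dist b c + dist c a + dist a b)) *\<^sub>R
       (dist b c *\<^sub>R a + dist c a *\<^sub>R b + dist a b *\<^sub>R c)"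

fun ct_split :: "triangle \<Rightarrow> point \<Rightarrow> triangle set" where
  "ct_split (a, b, c) z = {(z, b, c), (z, c, a), (z, a, b)}"

definition split_aspect_ratio :: "triangle set \<Rightarrow> real" where
  "split_aspect_ratio \<K> = Max (aspect_ratio ` \<K>)"

text \<open>Altitude with respect to the edge opposite the third vertex, which is the longest edge
  when the vertices are labeled by increasing length of the opposite edge.\<close>

fun altitude3 :: "triangle \<Rightarrow> real" where
  "altitude3 (a, b, c) = infdist c (affine hull {a, b})"

end

theory Submission
  imports Defs
begin

text \<open>
  Let \<open>D\<close> be twice the signed area of \<open>T\<close>, \<open>P\<close> its perimeter and \<open>z\<close> its incenter. The aspect ratio
  of any nondegenerate triangle is its longest edge times its perimeter over \<open>2 * \<bar>D\<bar>\<close>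
  (\<open>aspect_ratio_eq\<close>); this needs the existence and uniqueness of the incircle with the expected
  centre and radius (\<open>is_incircle_iff\<close>).

  The incenter is equidistant from the edges, so the area of the subtriangle on the edge \<open>e\<^sub>i\<close> is the
  fraction \<open>h\<^sub>i / P\<close> of the area of \<open>T\<close>, and \<open>h\<^sub>i\<close> is also the longest edge of that subtriangle.
  The factor \<open>h\<^sub>i\<close> cancels: the aspect ratio of the subtriangle is its perimeter times \<open>P / (2 * \<bar>D\<bar>)\<close>,
  while that of \<open>T\<close> is \<open>h\<^sub>3\<close> times the same factor (\<open>subtriangle_aspect\<close>). It remains to compare the
  perimeters of the subtriangles with \<open>h\<^sub>3\<close>.

  For the lower bound, the subtriangle on the longest edge has perimeter at least \<open>2 * h\<^sub>3\<close> by the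
  triangle inequality. For the upper bound, writing \<open>z\<close> as a weighted mean of the vertices bounds
  the perimeter of the subtriangle on \<open>e\<^sub>i\<close> by \<open>h\<^sub>i * (3 - 2 * h\<^sub>i / P)\<close>. This is increasing in \<open>h\<^sub>i\<close> in
  the relevant range, so it is largest for \<open>h\<^sub>3\<close>, where it equals
  \<open>2 * h\<^sub>3 + (h\<^sub>3 / P) * (h\<^sub>1 + h\<^sub>2 - h\<^sub>3)\<close>; and \<open>h\<^sub>1 + h\<^sub>2 - h\<^sub>3\<close> is at most twice the altitude on the
  longest edge (\<open>excess_le_altitude\<close>).
\<close>

section \<open>Signed areas\<close>

definition rot90 :: "point \<Rightarrow> point" where
  "rot90 v = vector [- (v $ 2), v $ 1]"

text \<open>Twice the signed area of the triangle \<open>p, q, x\<close>; equivalently \<open>dist p q\<close> times the signed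
  distance of \<open>x\<close> from the line through \<open>p\<close> and \<open>q\<close>. Leaving the factor \<open>dist p q\<close> in keeps the
  function affine in \<open>x\<close> and polynomial in all coordinates.\<close>

definition cross2 :: "point \<Rightarrow> point \<Rightarrow> point \<Rightarrow> real" where
  "cross2 p q x = rot90 (q - p) \<bullet> (x - p)"

lemma cross2_coords:
  "cross2 p q x = (q $ 1 - p $ 1) * (x $ 2 - p $ 2) - (q $ 2 - p $ 2) * (x $ 1 - p $ 1)"
  by (simp add: cross2_def rot90_def inner_vec_def sum_2 algebra_simps)

lemma norm_rot90 [simp]: "norm (rot90 v) = norm v"
  by (simp add: norm_eq_sqrt_inner rot90_def inner_vec_def sum_2 add.commute)

lemma cross2_rotate: "cross2 b c a = cross2 a b c"
  by (simp add: cross2_coords algebra_simps)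

lemma cross2_swap: "cross2 a c b = - cross2 a b c"
  by (simp add: cross2_coords algebra_simps)

lemma cross2_sum: "cross2 b c x + cross2 c a x + cross2 a b x = cross2 a b c"
  by (simp add: cross2_coords algebra_simps)

lemma cross2_diff: "cross2 p q x - cross2 p q y = rot90 (q - p) \<bullet> (x - y)"
  by (simp add: cross2_def inner_diff_right)

lemma cross2_degenerate [simp]: "cross2 p p x = 0" "cross2 p x p = 0" "cross2 x p p = 0"
  by (simp_all add: cross2_coords algebra_simps)

lemma cross2_affine:
  assumes "u + v + w = 1"
  shows "cross2 p q (u *\<^sub>R x + v *\<^sub>R y + w *\<^sub>R z) = u * cross2 p q x + v * cross2 p q y + w * cross2 p q z"
proof -
  have u: "u = 1 - v - w" using assms by simp
  show ?thesis unfolding u by (simp add: cross2_coords algebra_simps)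
qed

text \<open>By Lagrange's identity a vanishing cross product is the equality case of the
  Cauchy--Schwarz inequality.\<close>

lemma collinear_if_cross2_eq_0:
  assumes "cross2 a b c = 0"
  shows "collinear {a, b, c}"
proof -
  let ?v = "a - b" and ?w = "c - b"
  have "(?v \<bullet> ?w)\<^sup>2 + (cross2 a b c)\<^sup>2 = (?v \<bullet> ?v) * (?w \<bullet> ?w)"
    by (simp add: cross2_coords inner_vec_def sum_2 power2_eq_square algebra_simps)
  then have "(?v \<bullet> ?w)\<^sup>2 = (norm ?v * norm ?w)\<^sup>2"
    using assms by (simp add: power_mult_distrib power2_norm_eq_inner)
  then have "\<bar>?v \<bullet> ?w\<bar> = norm ?v * norm ?w"
    by (simp add: power2_eq_iff abs_if mult_nonneg_nonneg) (smt (verit) mult_nonneg_nonneg norm_ge_zero)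
  then show ?thesis
    by (simp add: norm_cauchy_schwarz_equal collinear_3[of a b c])
qed

section \<open>Barycentric coordinates\<close>

text \<open>Cramer's rule: the barycentric coordinates of a point are the ratios of signed areas.\<close>

lemma barycentric_cross2:
  assumes "cross2 a b c \<noteq> 0"
  shows "x = (cross2 b c x / cross2 a b c) *\<^sub>R a + (cross2 c a x / cross2 a b c) *\<^sub>R b
    + (cross2 a b x / cross2 a b c) *\<^sub>R c"
proof -
  have "cross2 a b c *\<^sub>R x = cross2 b c x *\<^sub>R a + cross2 c a x *\<^sub>R b + cross2 a b x *\<^sub>R c"
    by (simp add: vec_eq_iff forall_2 cross2_coords algebra_simps)
  then have "x = (1 / cross2 a b c) *\<^sub>R (cross2 b c x *\<^sub>R a + cross2 c a x *\<^sub>R b + cross2 a b x *\<^sub>R c)"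
    using assms by (metis divideR_right scaleR_one divide_inverse mult_1)
  then show ?thesis by (simp add: scaleR_add_right divide_inverse mult.commute)
qed

lemma mem_triangle_iff_cross2:
  assumes "cross2 a b c > 0"
  shows "x \<in> convex hull {a, b, c} \<longleftrightarrow>
    cross2 b c x \<ge> 0 \<and> cross2 c a x \<ge> 0 \<and> cross2 a b x \<ge> 0"
proof
  assume "x \<in> convex hull {a, b, c}"
  then obtain u v w where "u \<ge> 0" "v \<ge> 0" "w \<ge> 0" "u + v + w = 1"
    and x: "x = u *\<^sub>R a + v *\<^sub>R b + w *\<^sub>R c"
    unfolding convex_hull_3 by blast
  then show "cross2 b c x \<ge> 0 \<and> cross2 c a x \<ge> 0 \<and> cross2 a b x \<ge> 0"
    using assms cross2_rotate[of a b c] cross2_rotate[of b c a]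
    by (simp add: cross2_affine)
next
  assume *: "cross2 b c x \<ge> 0 \<and> cross2 c a x \<ge> 0 \<and> cross2 a b x \<ge> 0"
  have "cross2 b c x / cross2 a b c + cross2 c a x / cross2 a b c + cross2 a b x / cross2 a b c = 1"
    using assms cross2_sum[of b c x a] by (simp add: add_divide_distrib[symmetric])
  then show "x \<in> convex hull {a, b, c}"
    unfolding convex_hull_3 using barycentric_cross2[of a b c x] assms *
    by (smt (verit, best) divide_nonneg_pos mem_Collect_eq)
qed

lemma mem_edge_iff_cross2:
  assumes "cross2 a b c > 0" and "x \<in> convex hull {a, b, c}"
  shows "x \<in> closed_segment a b \<longleftrightarrow> cross2 a b x = 0"
proof
  assume "x \<in> closed_segment a b"
  then obtain u where "x = (1 - u) *\<^sub>R a + u *\<^sub>R b"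
    unfolding closed_segment_def by blast
  then show "cross2 a b x = 0"
    using cross2_affine[of "1 - u" u 0 a b a b 0] by simp
next
  assume 0: "cross2 a b x = 0"
  let ?u = "cross2 c a x / cross2 a b c"
  have "cross2 b c x / cross2 a b c + ?u = 1"
    using assms(1) cross2_sum[of b c x a] 0 by (simp add: add_divide_distrib[symmetric])
  then have u: "cross2 b c x / cross2 a b c = 1 - ?u" by simp
  have "cross2 b c x / cross2 a b c \<ge> 0" "?u \<ge> 0"
    using assms mem_triangle_iff_cross2 by auto
  moreover have "x = (1 - ?u) *\<^sub>R a + ?u *\<^sub>R b"
    using barycentric_cross2[of a b c x] assms(1) 0 u by simp
  ultimately show "x \<in> closed_segment a b"
    unfolding closed_segment_def using u by auto
qed

section \<open>Circles and lines\<close>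

lemma cross2_le_if_near:
  "cross2 p q x - cross2 p q y \<le> dist p q * dist x y"
  using norm_cauchy_schwarz[of "rot90 (q - p)" "x - y"]
  by (simp add: cross2_diff dist_norm norm_minus_commute)

text \<open>Moving from the centre of a circle against the normal \<open>rot90 (q - p)\<close>, which has length
  \<open>dist p q\<close>, gives the point of the circle where \<open>cross2 p q\<close> is smallest.\<close>

lemma lowest_point_of_circle:
  assumes "r > 0" and "p \<noteq> q"
  shows "m - (r / dist p q) *\<^sub>R rot90 (q - p) \<in> sphere m r"
    and "cross2 p q (m - (r / dist p q) *\<^sub>R rot90 (q - p)) = cross2 p q m - r * dist p q"
proof -
  let ?n = "rot90 (q - p)"
  let ?x = "m - (r / dist p q) *\<^sub>R ?n"
  have n: "norm ?n = dist p q" by (simp add: dist_norm norm_minus_commute)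
  show "?x \<in> sphere m r"
    using assms n by (simp add: dist_norm)
  have "cross2 p q m - cross2 p q ?x = r * dist p q"
    using assms(2) n by (simp add: cross2_diff power2_norm_eq_inner[symmetric] power2_eq_square)
  then show "cross2 p q ?x = cross2 p q m - r * dist p q" by simp
qed

lemma circle_in_half_plane:
  assumes "r > 0" and "p \<noteq> q" and "\<And>x. x \<in> sphere m r \<Longrightarrow> cross2 p q x \<ge> 0"
  shows "r * dist p q \<le> cross2 p q m"
  using assms(3)[OF lowest_point_of_circle(1)[OF assms(1,2)]] lowest_point_of_circle(2)[OF assms(1,2)]
  by simp

text \<open>Uniqueness is the equality case of the Cauchy--Schwarz inequality behind
  \<open>cross2_le_if_near\<close>.\<close>

lemma tangent_point_unique:
  assumes "r > 0" and "p \<noteq> q" and "cross2 p q m = r * dist p q"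
  shows "\<exists>!x. x \<in> sphere m r \<and> cross2 p q x = 0"
proof
  let ?n = "rot90 (q - p)"
  let ?x = "m - (r / dist p q) *\<^sub>R ?n"
  have n: "norm ?n = dist p q" by (simp add: dist_norm norm_minus_commute)
  show "?x \<in> sphere m r \<and> cross2 p q ?x = 0"
    using lowest_point_of_circle[OF assms(1,2)] assms(3) by simp
  fix x assume x: "x \<in> sphere m r \<and> cross2 p q x = 0"
  have "?n \<bullet> (m - x) = norm ?n * norm (m - x)"
    using x assms(3) n cross2_diff[of p q m x] by (simp add: dist_norm mult.commute)
  then have "norm ?n *\<^sub>R (m - x) = norm (m - x) *\<^sub>R ?n"
    unfolding norm_cauchy_schwarz_eq .
  then have "dist p q *\<^sub>R (m - x) = r *\<^sub>R ?n"
    using x n by (simp add: dist_norm)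
  then have "m - x = (r / dist p q) *\<^sub>R ?n"
    using assms(2) by (metis divideR_right dist_eq_0_iff divide_inverse mult.commute scaleR_scaleR)
  then show "x = ?x" by (simp add: algebra_simps)
qed

section \<open>The incircle\<close>

fun perimeter :: "triangle \<Rightarrow> real" where
  "perimeter (a, b, c) = dist b c + dist c a + dist a b"

text \<open>The weights defining the incenter are its barycentric coordinates, and \<open>cross2 b c\<close> is affine
  and vanishes at \<open>b\<close> and \<open>c\<close>. Divided by the edge lengths, the three values agree, so the incenter
  is equidistant from the three lines.\<close>

lemma cross2_incenter:
  assumes "cross2 a b c \<noteq> 0"
  shows "cross2 b c (incenter (a, b, c)) = dist b c * cross2 a b c / perimeter (a, b, c)" (is ?A)
    and "cross2 c a (incenter (a, b, c)) = dist c a * cross2 a b c / perimeter (a, b, c)" (is ?B)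
    and "cross2 a b (incenter (a, b, c)) = dist a b * cross2 a b c / perimeter (a, b, c)" (is ?C)
proof -
  define P where "P = perimeter (a, b, c)"
  have "P > 0" unfolding P_def using assms
    by (cases "a = b") (simp_all add: add_nonneg_pos)
  then have 1: "dist b c / P + dist c a / P + dist a b / P = 1"
    by (simp add: P_def add_divide_distrib[symmetric])
  have "incenter (a, b, c) = (dist b c / P) *\<^sub>R a + (dist c a / P) *\<^sub>R b + (dist a b / P) *\<^sub>R c"
    by (simp add: P_def scaleR_add_right)
  then show ?A ?B ?C
    unfolding P_def[symmetric] using cross2_affine[OF 1] cross2_rotate[of a b c] cross2_rotate[of b c a]
    by simp_all
qed

text \<open>A circle inside the triangle has its centre at distance at least \<open>r\<close> from each edge line, and a
  circle meeting an edge has it at distance at most \<open>r\<close>. Hence the barycentric coordinates of the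
  centre are proportional to the edge lengths, and since they sum to one the centre is the incenter
  and \<open>r\<close> is twice the area over the perimeter. Conversely that circle lies in the three half planes
  and touches each edge line once; the point of contact is in the triangle, hence on the edge.\<close>

lemma is_incircle_iff_positive:
  assumes D: "cross2 a b c > 0"
  shows "is_incircle (a, b, c) S \<longleftrightarrow>
    S = sphere (incenter (a, b, c)) (cross2 a b c / perimeter (a, b, c))"
proof -
  define P where "P = perimeter (a, b, c)"
  have ne: "a \<noteq> b" "b \<noteq> c" "c \<noteq> a" using D by auto
  have P: "P > 0" unfolding P_def using ne by (simp add: add_nonneg_pos)
  have D': "cross2 b c a > 0" "cross2 c a b > 0"
    using D cross2_rotate[of a b c] cross2_rotate[of b c a] by simp_all
  have hull: "convex hull {b, c, a} = convex hull {a, b, c}" "convex hull {c, a, b} = convex hull {a, b, c}"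
    by (simp_all add: insert_commute)
  note edge = mem_edge_iff_cross2[OF D] mem_edge_iff_cross2[OF D'(1), unfolded hull]
    mem_edge_iff_cross2[OF D'(2), unfolded hull]
  note inside = mem_triangle_iff_cross2[OF D]
  show ?thesis unfolding P_def[symmetric]
  proof
    assume "is_incircle (a, b, c) S"
    then obtain m r where r: "r > 0" and S: "S = sphere m r" and sub: "S \<subseteq> convex hull {a, b, c}"
      and tan: "\<exists>x \<in> S. x \<in> closed_segment a b" "\<exists>x \<in> S. x \<in> closed_segment b c"
        "\<exists>x \<in> S. x \<in> closed_segment c a"
      unfolding is_incircle_def by (auto simp: Ex1_def) 
    have touch: "cross2 p q m = r * dist p q"
      if "p \<noteq> q" and "\<And>x. x \<in> S \<Longrightarrow> cross2 p q x \<ge> 0" and "\<exists>x \<in> S. cross2 p q x = 0" for p q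
    proof (rule antisym)
      obtain x where "x \<in> S" "cross2 p q x = 0" using \<open>\<exists>x \<in> S. cross2 p q x = 0\<close> by blast
      then show "cross2 p q m \<le> r * dist p q"
        using cross2_le_if_near[of p q m x] S by (simp add: mult.commute)
      show "r * dist p q \<le> cross2 p q m"
        using circle_in_half_plane[OF r \<open>p \<noteq> q\<close>] that(2) S by blast
    qed
    have m: "cross2 a b m = r * dist a b" "cross2 b c m = r * dist b c" "cross2 c a m = r * dist c a"
      using touch[OF ne(1)] touch[OF ne(2)] touch[OF ne(3)] sub inside edge tan by blast+
    have "cross2 a b c = r * P"
      using cross2_sum[of b c m a] m by (simp add: P_def algebra_simps)
    then have rP: "r = cross2 a b c / P" using P by simp
    then have "r / cross2 a b c = 1 / P" using D by simp
    moreover have "m = (r / cross2 a b c) *\<^sub>R (dist b c *\<^sub>R a + dist c a *\<^sub>R b + dist a b *\<^sub>R c)"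
      using barycentric_cross2[of a b c m] D by (simp add: m scaleR_add_right)
    ultimately have "m = incenter (a, b, c)" by (simp add: P_def)
    then show "S = sphere (incenter (a, b, c)) (cross2 a b c / P)" using S rP by simp
  next
    define m where "m = incenter (a, b, c)"
    define r where "r = cross2 a b c / P"
    assume "S = sphere (incenter (a, b, c)) (cross2 a b c / P)"
    then have S: "S = sphere m r" by (simp add: m_def r_def)
    have r: "r > 0" using D P by (simp add: r_def)
    have m: "cross2 a b m = r * dist a b" "cross2 b c m = r * dist b c" "cross2 c a m = r * dist c a"
      using cross2_incenter[of a b c] D by (simp_all add: m_def r_def P_def)
    have pos: "cross2 p q x \<ge> 0" if "x \<in> S" "cross2 p q m = r * dist p q" for p q x
      using cross2_le_if_near[of p q m x] that S by (simp add: mult.commute)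
    have sub: "S \<subseteq> convex hull {a, b, c}" using pos m inside by blast
    have once: "\<exists>!x. x \<in> S \<inter> closed_segment p q"
      if "p \<noteq> q" and "cross2 p q m = r * dist p q"
        and "\<And>x. x \<in> convex hull {a, b, c} \<Longrightarrow> x \<in> closed_segment p q \<longleftrightarrow> cross2 p q x = 0" for p q
    proof -
      have "x \<in> S \<inter> closed_segment p q \<longleftrightarrow> x \<in> sphere m r \<and> cross2 p q x = 0" for x
        using that(3) sub S by blast
      then show ?thesis using tangent_point_unique[OF r that(1,2)] by simp
    qed
    have "\<exists>!x. x \<in> S \<inter> closed_segment a b" "\<exists>!x. x \<in> S \<inter> closed_segment b c"
      "\<exists>!x. x \<in> S \<inter> closed_segment c a"
      using once ne m edge by blast+
    then show "is_incircle (a, b, c) S"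
      unfolding is_incircle_def using S r sub by auto
  qed
qed

lemma is_incircle_iff:
  assumes "cross2 a b c \<noteq> 0"
  shows "is_incircle (a, b, c) S \<longleftrightarrow>
    S = sphere (incenter (a, b, c)) (\<bar>cross2 a b c\<bar> / perimeter (a, b, c))"
proof (cases "cross2 a b c > 0")
  case True
  then show ?thesis using is_incircle_iff_positive by simp
next
  case False
  \<comment> \<open>Exchanging two vertices reverses the orientation but changes neither point set nor edges.\<close>
  then have "cross2 a c b > 0" using assms cross2_swap[of a c b] by simp
  moreover have "is_incircle (a, b, c) S = is_incircle (a, c, b) S"
    by (simp add: is_incircle_def insert_commute closed_segment_commute conj_ac)
  moreover have "incenter (a, c, b) = incenter (a, b, c)" "perimeter (a, c, b) = perimeter (a, b, c)"
    by (simp_all add: dist_commute add_ac)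
  ultimately show ?thesis
    using is_incircle_iff_positive[of a c b S] False cross2_swap[of a c b]
    by (simp del: incenter.simps perimeter.simps)
qed

section \<open>Aspect ratios\<close>

lemma diameter_sphere:
  fixes m :: "'a::euclidean_space"
  assumes "r \<ge> 0"
  shows "diameter (sphere m r) = 2 * r"
proof (rule antisym)
  have "diameter (sphere m r) \<le> diameter (cball m r)"
    by (rule diameter_subset) auto
  then show "diameter (sphere m r) \<le> 2 * r" using assms by simp
  obtain e :: 'a where e: "norm e = 1" using vector_choose_size[of 1] by auto
  have "m + r *\<^sub>R e \<in> sphere m r" "m - r *\<^sub>R e \<in> sphere m r"
    using assms e by (simp_all add: dist_norm)
  then have "dist (m + r *\<^sub>R e) (m - r *\<^sub>R e) \<le> diameter (sphere m r)"
    by (intro diameter_bounded_bound) simp_all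
  moreover have "(m + r *\<^sub>R e) - (m - r *\<^sub>R e) = (2 * r) *\<^sub>R e"
    by (simp flip: scaleR_left_distrib)
  then have "dist (m + r *\<^sub>R e) (m - r *\<^sub>R e) = 2 * r"
    unfolding dist_norm using assms e by simp
  ultimately show "2 * r \<le> diameter (sphere m r)" by simp
qed

text \<open>The incircle diameter is four times the area over the perimeter, and \<open>cross2\<close> is twice the
  area up to sign.\<close>

lemma aspect_ratio_eq:
  assumes "cross2 a b c \<noteq> 0"
  shows "aspect_ratio (a, b, c)
    = longest_edge (a, b, c) * perimeter (a, b, c) / (2 * \<bar>cross2 a b c\<bar>)"
proof -
  have "incircle (a, b, c) = sphere (incenter (a, b, c)) (\<bar>cross2 a b c\<bar> / perimeter (a, b, c))"
    unfolding incircle_def by (rule the_equality) (simp_all only: is_incircle_iff[OF assms])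
  moreover have "\<bar>cross2 a b c\<bar> / perimeter (a, b, c) \<ge> 0" by simp
  ultimately have "incircle_diameter (a, b, c) = 2 * (\<bar>cross2 a b c\<bar> / perimeter (a, b, c))"
    unfolding incircle_diameter_def by (simp only: diameter_sphere)
  then show ?thesis by (simp add: aspect_ratio_def)
qed

section \<open>Splitting at the incenter\<close>

lemma incenter_rotate: "incenter (b, c, a) = incenter (a, b, c)"
  by (simp add: add_ac)

text \<open>Weighted with the edge lengths, the vector from \<open>b\<close> to the incenter is a combination of the two
  edge vectors at \<open>b\<close>, in which each has the length of the other as its coefficient.\<close>

lemma dist_incenter_le:
  assumes "a \<noteq> b"
  shows "dist (incenter (a, b, c)) b \<le> 2 * dist b c * dist a b / perimeter (a, b, c)"
proof -
  define P where "P = perimeter (a, b, c)"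
  have P: "P > 0" using assms by (simp add: P_def add_nonneg_pos)
  let ?S = "dist b c *\<^sub>R a + dist c a *\<^sub>R b + dist a b *\<^sub>R c"
  have "incenter (a, b, c) = (1 / P) *\<^sub>R ?S" by (simp add: P_def)
  then have "P *\<^sub>R incenter (a, b, c) = ?S" using P by (simp del: incenter.simps)
  moreover have "P *\<^sub>R b = dist b c *\<^sub>R b + dist c a *\<^sub>R b + dist a b *\<^sub>R b"
    by (simp only: P_def perimeter.simps scaleR_left_distrib)
  ultimately have "P *\<^sub>R (incenter (a, b, c) - b) = dist b c *\<^sub>R (a - b) + dist a b *\<^sub>R (c - b)"
    by (simp add: scaleR_diff_right del: incenter.simps)
  then have "norm (P *\<^sub>R (incenter (a, b, c) - b)) \<le> dist b c * dist a b + dist a b * dist b c"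
    using norm_triangle_ineq[of "dist b c *\<^sub>R (a - b)" "dist a b *\<^sub>R (c - b)"]
    by (simp add: dist_norm norm_minus_commute[of c b] del: incenter.simps)
  then have "dist (incenter (a, b, c)) b * P \<le> 2 * dist b c * dist a b"
    using P by (simp add: dist_norm mult.commute del: incenter.simps)
  then show ?thesis using P
    by (simp add: P_def[symmetric] pos_le_divide_eq del: incenter.simps perimeter.simps)
qed

text \<open>By the triangle inequality no edge exceeds half the perimeter, so the bound on the distances
  from the incenter shows that \<open>b c\<close> is the longest edge of the subtriangle \<open>z, b, c\<close>. The area of
  that subtriangle is also proportional to \<open>dist b c\<close>, so this factor cancels in the aspect ratio
  and only the perimeter of the subtriangle remains. The same distance bounds control the
  perimeter.\<close>

lemma subtriangle_aspect:
  assumes "cross2 a b c \<noteq> 0"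
  defines "z \<equiv> incenter (a, b, c)"
  shows "aspect_ratio (z, b, c) = perimeter (z, b, c) * perimeter (a, b, c) / (2 * \<bar>cross2 a b c\<bar>)"
    and "perimeter (z, b, c) \<le> dist b c * (3 - 2 * dist b c / perimeter (a, b, c))"
proof -
  define P where "P = perimeter (a, b, c)"
  have ne: "a \<noteq> b" "b \<noteq> c" "c \<noteq> a" using assms by auto
  have P: "P > 0" unfolding P_def using ne by (simp add: add_nonneg_pos)
  have b: "dist z b \<le> dist b c * (2 * dist a b / P)"
    using dist_incenter_le[of a b c] ne by (simp add: z_def P_def mult_ac)
  have "z = incenter (b, c, a)" by (simp only: z_def incenter_rotate)
  moreover have "perimeter (b, c, a) = P" by (simp add: P_def)
  ultimately have c: "dist z c \<le> dist b c * (2 * dist c a / P)"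
    using dist_incenter_le[of b c a] ne by (simp add: mult_ac)
  have "2 * dist a b / P \<le> 1" "2 * dist c a / P \<le> 1"
    using P dist_triangle[of a b c] dist_triangle[of c a b] by (simp_all add: P_def dist_commute)
  then have "dist b c * (2 * dist a b / P) \<le> dist b c" "dist b c * (2 * dist c a / P) \<le> dist b c"
    by (metis mult_left_le zero_le_dist)+
  with b c have "longest_edge (z, b, c) = dist b c"
    by (simp add: dist_commute)
  moreover have d: "cross2 z b c = dist b c * cross2 a b c / P"
    using cross2_incenter(1)[OF assms(1)] cross2_rotate[of b c z]
    by (simp add: z_def P_def del: incenter.simps perimeter.simps)
  ultimately have "aspect_ratio (z, b, c)
      = dist b c * perimeter (z, b, c) / (2 * (dist b c * \<bar>cross2 a b c\<bar> / P))"
    using aspect_ratio_eq[of z b c] ne P assms(1) by (simp add: abs_mult del: perimeter.simps)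
  then show "aspect_ratio (z, b, c) = perimeter (z, b, c) * perimeter (a, b, c) / (2 * \<bar>cross2 a b c\<bar>)"
    unfolding P_def[symmetric] using ne by (simp add: mult.left_commute del: perimeter.simps)
  have "dist b c / P + dist c a / P + dist a b / P = 1"
    using P by (simp add: P_def add_divide_distrib[symmetric])
  then have e: "3 - 2 * dist b c / P = 1 + 2 * dist a b / P + 2 * dist c a / P" by simp
  have "dist b c * (3 - 2 * dist b c / P)
      = dist b c + dist b c * (2 * dist a b / P) + dist b c * (2 * dist c a / P)"
    unfolding e by (simp add: distrib_left)
  with b c show "perimeter (z, b, c) \<le> dist b c * (3 - 2 * dist b c / perimeter (a, b, c))"
    unfolding P_def[symmetric] by (simp add: dist_commute)
qed

section \<open>The altitude on the longest edge\<close>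

text \<open>Since \<open>c\<close> is no farther from \<open>e\<close> than \<open>q\<close> is, the angle of the triangle \<open>e, q, c\<close> at \<open>q\<close>
  is not obtuse, so the angle at \<open>q\<close> between \<open>c\<close> and the continuation of the segment is at least a right
  angle, and moving on from \<open>q\<close> cannot bring one closer to \<open>c\<close>.\<close>

lemma dist_le_beyond_segment:
  fixes c e q :: "'a::real_inner"
  assumes "dist c e \<le> dist e q" and "s \<ge> 0"
  shows "dist c q \<le> dist c (q + s *\<^sub>R (q - e))" (is "_ \<le> dist c ?p")
proof -
  have "(c - e) \<bullet> (q - e) \<le> norm (c - e) * norm (q - e)"
    by (rule norm_cauchy_schwarz)
  also have "\<dots> \<le> norm (q - e) * norm (q - e)"
    using assms(1) by (intro mult_right_mono) (simp_all add: dist_norm norm_minus_commute)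
  also have "\<dots> = (q - e) \<bullet> (q - e)"
    by (simp add: power2_norm_eq_inner[symmetric] power2_eq_square)
  finally have "(c - q) \<bullet> (q - e) \<le> 0"
    by (simp add: inner_diff_left)
  then have "s * ((c - q) \<bullet> (q - e)) \<le> 0" using assms(2) by (simp add: mult_nonneg_nonpos)
  moreover have "(c - ?p) \<bullet> (c - ?p) = (c - q) \<bullet> (c - q) - 2 * (s * ((c - q) \<bullet> (q - e)))
     + (s *\<^sub>R (q - e)) \<bullet> (s *\<^sub>R (q - e))"
    by (simp add: inner_diff_left inner_diff_right inner_add_left inner_add_right
        inner_commute algebra_simps)
  moreover have "(s *\<^sub>R (q - e)) \<bullet> (s *\<^sub>R (q - e)) \<ge> 0" by (rule inner_ge_zero)
  ultimately have "(c - q) \<bullet> (c - q) \<le> (c - ?p) \<bullet> (c - ?p)" by linarith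
  then show ?thesis by (simp add: dist_norm norm_le)
qed

text \<open>For a point \<open>p\<close> of the longest edge this is the sum of the triangle inequalities in the two
  triangles into which \<open>p\<close> cuts the given one. A point of the line outside that edge is, by the
  previous lemma, at least as far from \<open>c\<close> as the nearer endpoint of the edge, and the left-hand side
  is at most either of the two shorter edges.\<close>

lemma excess_le_altitude:
  assumes "dist b c \<le> dist a b" "dist c a \<le> dist a b"
  shows "dist b c + dist c a - dist a b \<le> 2 * altitude3 (a, b, c)"
proof -
  have "(dist b c + dist c a - dist a b) / 2 \<le> dist c p" if p_line: "p \<in> affine hull {a, b}" for p
  proof -
    obtain u v where p: "p = u *\<^sub>R a + v *\<^sub>R b" and uv: "u + v = 1"
      using p_line unfolding affine_hull_2 by blast
    consider "v < 0" | "v > 1" | "0 \<le> v" "v \<le> 1" by linarith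
    then show ?thesis
    proof cases
      case 1
      have u: "u = 1 - v" using uv by simp
      have "p = a + (- v) *\<^sub>R (a - b)" unfolding p u by (simp add: algebra_simps)
      then have "dist c a \<le> dist c p" using dist_le_beyond_segment[of c b a "- v"] assms 1
        by (simp add: dist_commute)
      then show ?thesis using assms zero_le_dist[of c p] by argo
    next
      case 2
      have u: "u = 1 - v" using uv by simp
      have "p = b + (v - 1) *\<^sub>R (b - a)" unfolding p u by (simp add: algebra_simps)
      then have "dist c b \<le> dist c p" using dist_le_beyond_segment[of c a b "v - 1"] assms 2
        by (simp add: dist_commute)
      then show ?thesis using assms zero_le_dist[of c p] dist_commute[of b c] by argo
    next
      case 3
      have u: "u = 1 - v" using uv by simp
      then have "p \<in> closed_segment a b" using p 3 by (auto simp: closed_segment_def)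
      then have "dist a b = dist a p + dist p b"
        by (metis between between_mem_segment)
      then show ?thesis using dist_triangle[of b c p] dist_triangle[of c a p] by (simp add: dist_commute)
    qed
  qed
  then have "(dist b c + dist c a - dist a b) / 2 \<le> infdist c (affine hull {a, b})"
    by (subst infdist_notempty) (simp, rule cINF_greatest, simp_all del: divide_le_eq_numeral1)
  then show ?thesis by simp
qed

section \<open>The aspect ratio of the split\<close>

theorem lemma2p6:
  fixes z1 z2 z3 :: "real ^ 2" and T :: triangle
  assumes "T = (z1, z2, z3)"
    and "nondegenerate T"
    and "dist z2 z3 \<le> dist z3 z1" and "dist z3 z1 \<le> dist z1 z2"
  shows "2 * aspect_ratio T \<le> split_aspect_ratio (ct_split T (incenter T)) \<and>
         split_aspect_ratio (ct_split T (incenter T))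
           \<le> 2 * (1 + altitude3 T / longest_edge T) * aspect_ratio T"
proof -
  define D where "D = cross2 z1 z2 z3"
  define P where "P = perimeter T"
  define z where "z = incenter T"
  define Q where "Q = P / (2 * \<bar>D\<bar>)"
  define h where "h = dist z1 z2"
  define \<alpha> where "\<alpha> = altitude3 T"
  have D: "D \<noteq> 0" using assms(1,2) collinear_if_cross2_eq_0 by (auto simp: D_def)
  then have ne: "z1 \<noteq> z2" "z2 \<noteq> z3" "z3 \<noteq> z1" by (auto simp: D_def)
  have h: "h > 0" using ne by (simp add: h_def)
  have P: "P > 0" using ne by (simp add: P_def assms(1) add_nonneg_pos)
  have Q: "Q > 0" using P D by (simp add: Q_def)
  have rot: "cross2 z2 z3 z1 = D" "cross2 z3 z1 z2 = D" "perimeter (z2, z3, z1) = P"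
    "perimeter (z3, z1, z2) = P" "incenter (z2, z3, z1) = z" "incenter (z3, z1, z2) = z"
    using cross2_rotate[of z1 z2 z3] cross2_rotate[of z2 z3 z1]
      incenter_rotate[of z2 z3 z1] incenter_rotate[of z3 z1 z2]
    by (simp_all add: D_def P_def z_def assms(1) del: incenter.simps)
  have longest: "longest_edge T = h" using assms by (simp add: h_def)
  have AT: "aspect_ratio T = h * Q"
    using aspect_ratio_eq[of z1 z2 z3] D longest by (simp add: assms(1) D_def P_def Q_def)
  have K: "aspect_ratio (z, z2, z3) = perimeter (z, z2, z3) * Q"
    "aspect_ratio (z, z3, z1) = perimeter (z, z3, z1) * Q"
    "aspect_ratio (z, z1, z2) = perimeter (z, z1, z2) * Q"
    using subtriangle_aspect(1)[of z1 z2 z3] subtriangle_aspect(1)[of z2 z3 z1]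
      subtriangle_aspect(1)[of z3 z1 z2] D rot
    unfolding Q_def by (simp_all add: assms(1) D_def P_def z_def del: incenter.simps perimeter.simps)
  have split: "split_aspect_ratio (ct_split T z) = Max {aspect_ratio (z, z2, z3),
     aspect_ratio (z, z3, z1), aspect_ratio (z, z1, z2)}"
    by (simp add: split_aspect_ratio_def assms(1))
  have "2 * h \<le> perimeter (z, z1, z2)"
    using dist_triangle[of z1 z2 z] by (simp add: h_def dist_commute)
  then have "2 * aspect_ratio T \<le> aspect_ratio (z, z1, z2)"
    using Q AT K(3) by (simp del: perimeter.simps)
  then have lower: "2 * aspect_ratio T \<le> split_aspect_ratio (ct_split T z)"
    unfolding split by (simp del: perimeter.simps)
  have hP: "2 * h \<le> P"
    using dist_triangle[of z1 z2 z3] by (simp add: h_def P_def assms(1) dist_commute)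
  have mono: "x * (3 - 2 * x / P) \<le> 2 * (h + \<alpha>)" if "0 \<le> x" "x \<le> h" for x
  proof -
    \<comment> \<open>After multiplying by \<open>P\<close>, this product is the difference of the two sides below.\<close>
    have "h - x \<ge> 0" "3 * P - 2 * (x + h) \<ge> 0" using that hP h by argo+
    then have "0 \<le> (h - x) * (3 * P - 2 * (x + h))" by (rule mult_nonneg_nonneg)
    then have "P * (x * (3 - 2 * x / P)) \<le> P * (h * (3 - 2 * h / P))"
      using P by (simp add: algebra_simps)
    then have "x * (3 - 2 * x / P) \<le> h * (3 - 2 * h / P)" using P by simp
    also have "\<dots> = 2 * h + (h / P) * (P - 2 * h)" using P by (simp add: field_simps)
    also have "\<dots> \<le> 2 * h + 1 * (P - 2 * h)"
      using hP P h by (intro add_left_mono mult_right_mono) simp_all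
    also have "P - 2 * h \<le> 2 * \<alpha>"
      using excess_le_altitude[of z2 z3 z1] assms by (simp add: h_def P_def \<alpha>_def)
    finally show ?thesis by simp
  qed
  have "perimeter (z, z2, z3) \<le> 2 * (h + \<alpha>)" "perimeter (z, z3, z1) \<le> 2 * (h + \<alpha>)"
    "perimeter (z, z1, z2) \<le> 2 * (h + \<alpha>)"
    using subtriangle_aspect(2)[of z1 z2 z3] mono[of "dist z2 z3"]
      subtriangle_aspect(2)[of z2 z3 z1] mono[of "dist z3 z1"]
      subtriangle_aspect(2)[of z3 z1 z2] mono[of "dist z1 z2"] D rot assms
    by (simp_all add: D_def P_def z_def h_def del: incenter.simps perimeter.simps)
  then have "split_aspect_ratio (ct_split T z) \<le> 2 * (h + \<alpha>) * Q"
    unfolding split using Q K by (simp add: mult_right_mono del: perimeter.simps)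
  also have "\<dots> = 2 * (1 + \<alpha> / h) * aspect_ratio T" using h AT by (simp add: field_simps)
  finally show ?thesis using lower unfolding z_def \<alpha>_def longest by simp
qed

end
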